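(* Let $m\ge2$ and let $\mathcal L$ be the affine congruence lattice of a spin lens space of dimension $2m-1$ with fundamental group of order $q$. Then for every integer $k\ge0$ and every $\epsilon\in\mathbb Z$, $$N_{\mathcal L}(\epsilon,k)=\sum_{\beta=0}^{\lfloor k/q\rfloor}\binom{\beta+m-1}{m-1}\,N^{\mathrm{red}}_{\mathcal L}(\epsilon,k-\beta q).$$
   Context: Let $\mathbb E^m=(\tfrac12+\mathbb Z)^m$, whose elements are written $\tfrac12(a_1,\dots,a_m)$ with all $a_j$ odd integers. A lens space of dimension $2m-1$ with fundamental group of order $q$ is $L(q;s)=\langle\gamma\rangle\backslash S^{2m-1}$, where $s=(s_1,\dots,s_m)\in\mathbb Z^m$ has all entries coprime to $q$ and $\gamma\in \mathrm{SO}(2m)$ is block diagonal with $j$-th block the rotation by $2\pi s_j/q$. If $q$ is odd it has exactly one spin structure, with associated affine congruence lattice $\mathcal L(q;s)=\{\tfrac12(a_1,\dots,a_m)\in\mathbb E^m:\sum_ja_js_j\equiv0\pmod q\}$. If $q$ is even it is spin only if $m$ is even; then there are exactly two spin structures $\tau_h$, $h\in\{0,1\}$, given by $\tau_h(\gamma^k)=(-1)^{k(h+h_{q;s})}\prod_{j=1}^m\big(\cos(\tfrac{ks_j\pi}{q})+\sin(\tfrac{ks_j\pi}{q})\,e_{2j-1}e_{2j}\big)\in\mathrm{Spin}(2m)$ with $h_{q;s}=\sum_j\lfloor s_j/q\rfloor$, and the affine congruence lattice associated to $\tau_h$ is $\mathcal L(q;s;h+h_{q;s})$, where $\mathcal L(q;s;h)=\{\tfrac12(a_1,\dots,a_m)\in\mathbb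 E^m:\sum_ja_js_j\equiv hq\pmod{2q}\}$. For $\mu=\tfrac12(a_1,\dots,a_m)\in\mathbb E^m$ put $\|\mu\|_1=\tfrac12\sum_j|a_j|$ and $R(\mu)=\#\{j:a_j<0\}$. For $\mathcal L\subset\mathbb E^m$, $\epsilon\in\mathbb Z$, $k\ge0$: $N_{\mathcal L}(\epsilon,k)=\#\{\mu\in\mathcal L:\ \|\mu\|_1=k+\tfrac m2,\ R(\mu)\equiv\epsilon\pmod 2\}$. Let $C(q)=\{\tfrac12(a_1,\dots,a_m)\in\mathbb E^m:|\tfrac{a_j}{2}|<q\ \forall j\}$ and $N^{\mathrm{red}}_{\mathcal L}(\epsilon,k)=\#\{\mu\in\mathcal L\cap C(q):\ \|\mu\|_1=k+\tfrac m2,\ R(\mu)\equiv\epsilon\pmod2\}$. *)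

theory Defs
  imports Complex_Main "HOL-Number_Theory.Cong" "Jordan_Normal_Form.Matrix"
begin

section \<open>Real Clifford algebras and spin groups\<close>

text \<open>An element of the Clifford algebra on \<open>n\<close> anticommuting generators
  \<open>e 0, \<dots>, e (n - 1)\<close> with \<open>e i * e i = - 1\<close> is given by its coefficients with respect to the
  basis of increasing products of generators, indexed by the subsets of \<open>{..<n}\<close>.\<close>

type_synonym cliff = "nat set \<Rightarrow> real"

text \<open>The sign in (product over \<open>S\<close>) * (product over \<open>T\<close>) = \<open>\<plusminus>\<close> (product over the symmetric
  difference): one factor \<open>- 1\<close> for each transposition needed for sorting, and one for each
  square \<open>e i * e i\<close>.\<close>

definition cl_sign :: "nat set \<Rightarrow> nat set \<Rightarrow> real" where
  "cl_sign S T = (- 1) ^ (card {(i, j). i \<in> S \<and> j \<in> T \<and> j < i} + card (S \<inter> T))"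

definition cl_mult :: "nat \<Rightarrow> cliff \<Rightarrow> cliff \<Rightarrow> cliff" where
  "cl_mult n x y = (\<lambda>U.
     \<Sum>(S, T) \<in> {(S, T). S \<subseteq> {..<n} \<and> T \<subseteq> {..<n} \<and> (S - T) \<union> (T - S) = U}.
       cl_sign S T * x S * y T)"

definition cl_one :: cliff where
  "cl_one = (\<lambda>S. if S = {} then 1 else 0)"

definition cl_gen :: "nat \<Rightarrow> cliff" where
  "cl_gen i = (\<lambda>S. if S = {i} then 1 else 0)"

definition cl_vec :: "real vec \<Rightarrow> cliff" where
  "cl_vec v = (\<lambda>S. \<Sum>i<dim_vec v. v $ i * cl_gen i S)"

inductive_set Spin :: "nat \<Rightarrow> cliff set" for n :: nat where
  one: "cl_one \<in> Spin n"
| mult: "x \<in> Spin n \<Longrightarrow> v \<in> carrier_vec n \<Longrightarrow> w \<in> carrier_vec n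
    \<Longrightarrow> v \<bullet> v = 1 \<Longrightarrow> w \<bullet> w = 1
    \<Longrightarrow> cl_mult n x (cl_mult n (cl_vec v) (cl_vec w)) \<in> Spin n"

text \<open>\<open>A\<close> is the image of \<open>x\<close> under the double covering of \<open>SO(n)\<close> by \<open>Spin(n)\<close>, i.e.
  \<open>A v = x v x\<^sup>-\<^sup>1\<close> for all vectors \<open>v\<close>.\<close>

definition spin_covers :: "nat \<Rightarrow> cliff \<Rightarrow> real mat \<Rightarrow> bool" where
  "spin_covers n x A \<longleftrightarrow> A \<in> carrier_mat n n \<and>
     (\<forall>v \<in> carrier_vec n. cl_mult n x (cl_vec v) = cl_mult n (cl_vec (A *\<^sub>v v)) x)"


section \<open>Spin lens spaces\<close>

text \<open>All indices start at \<open>0\<close>: the \<open>j\<close>-th rotation block (\<open>j < m\<close>) acts on the coordinates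
  \<open>2 * j\<close> and \<open>2 * j + 1\<close>.\<close>

definition lens_gen :: "nat \<Rightarrow> nat \<Rightarrow> int vec \<Rightarrow> real mat" where
  "lens_gen m q s = mat (2 * m) (2 * m) (\<lambda>(a, b).
     let \<theta> = 2 * pi * real_of_int (s $ (a div 2)) / real q in
     if a div 2 \<noteq> b div 2 then 0
     else if a = b then cos \<theta>
     else if a < b then - sin \<theta>
     else sin \<theta>)"

definition lens_group :: "nat \<Rightarrow> nat \<Rightarrow> int vec \<Rightarrow> real mat set" where
  "lens_group m q s = {lens_gen m q s ^\<^sub>m k | k. True}"

text \<open>A spin structure on the quotient of the sphere of dimension \<open>2 * m - 1\<close> by the group
  \<open>lens_group m q s\<close> is a homomorphism from this group to \<open>Spin(2 * m)\<close> that lifts the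
  inclusion into \<open>SO(2 * m)\<close>.\<close>

definition spin_structure :: "nat \<Rightarrow> nat \<Rightarrow> int vec \<Rightarrow> (real mat \<Rightarrow> cliff) \<Rightarrow> bool" where
  "spin_structure m q s \<tau> \<longleftrightarrow>
     (\<forall>A \<in> lens_group m q s. \<tau> A \<in> Spin (2 * m) \<and> spin_covers (2 * m) (\<tau> A) A) \<and>
     (\<forall>A \<in> lens_group m q s. \<forall>B \<in> lens_group m q s. \<tau> (A * B) = cl_mult (2 * m) (\<tau> A) (\<tau> B))"

definition spin_lens_space :: "nat \<Rightarrow> nat \<Rightarrow> int vec \<Rightarrow> (real mat \<Rightarrow> cliff) \<Rightarrow> bool" where
  "spin_lens_space m q s \<tau> \<longleftrightarrow>
     0 < q \<and> s \<in> carrier_vec m \<and> (\<forall>j<m. coprime (s $ j) (int q)) \<and> spin_structure m q s \<tau>"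

definition h_shift :: "nat \<Rightarrow> nat \<Rightarrow> int vec \<Rightarrow> int" where
  "h_shift m q s = (\<Sum>j<m. \<lfloor>real_of_int (s $ j) / real q\<rfloor>)"

primrec cl_prod :: "nat \<Rightarrow> (nat \<Rightarrow> cliff) \<Rightarrow> nat \<Rightarrow> cliff" where
  "cl_prod n f 0 = cl_one"
| "cl_prod n f (Suc j) = cl_mult n (cl_prod n f j) (f j)"

text \<open>For even \<open>q\<close>: \<open>\<tau>\<close> is the spin structure with label \<open>h \<in> {0, 1}\<close>.\<close>

definition spin_structure_label ::
    "nat \<Rightarrow> nat \<Rightarrow> int vec \<Rightarrow> int \<Rightarrow> (real mat \<Rightarrow> cliff) \<Rightarrow> bool" where
  "spin_structure_label m q s h \<tau> \<longleftrightarrow> (\<forall>k::nat.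
     \<tau> (lens_gen m q s ^\<^sub>m k) = (\<lambda>S.
       (- 1) powi (int k * (h + h_shift m q s)) *
       cl_prod (2 * m) (\<lambda>j T.
         cos (real k * real_of_int (s $ j) * pi / real q) * cl_one T +
         sin (real k * real_of_int (s $ j) * pi / real q) *
           cl_mult (2 * m) (cl_gen (2 * j)) (cl_gen (2 * j + 1)) T) m S))"


section \<open>Affine congruence lattices\<close>

definition half :: "int vec \<Rightarrow> real vec" where
  "half a = map_vec (\<lambda>x. real_of_int x / 2) a"

definition half_odd :: "nat \<Rightarrow> real vec set" where
  "half_odd m = {half a | a. a \<in> carrier_vec m \<and> (\<forall>j<m. odd (a $ j))}"

definition lattice_odd :: "nat \<Rightarrow> nat \<Rightarrow> int vec \<Rightarrow> real vec set" where
  "lattice_odd m q s =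
     {half a | a. half a \<in> half_odd m \<and> [(\<Sum>j<m. a $ j * s $ j) = 0] (mod int q)}"

definition lattice_even :: "nat \<Rightarrow> nat \<Rightarrow> int vec \<Rightarrow> int \<Rightarrow> real vec set" where
  "lattice_even m q s h =
     {half a | a. half a \<in> half_odd m \<and> [(\<Sum>j<m. a $ j * s $ j) = h * int q] (mod 2 * int q)}"

definition affine_congruence_lattice ::
    "nat \<Rightarrow> nat \<Rightarrow> int vec \<Rightarrow> (real mat \<Rightarrow> cliff) \<Rightarrow> real vec set \<Rightarrow> bool" where
  "affine_congruence_lattice m q s \<tau> L \<longleftrightarrow>
     (if odd q then L = lattice_odd m q s
      else \<exists>h \<in> {0, 1}. spin_structure_label m q s h \<tau> \<and>
             L = lattice_even m q s (h + h_shift m q s))"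

definition norm1 :: "real vec \<Rightarrow> real" where
  "norm1 \<mu> = (\<Sum>j<dim_vec \<mu>. \<bar>\<mu> $ j\<bar>)"

definition num_neg :: "real vec \<Rightarrow> nat" where
  "num_neg \<mu> = card {j. j < dim_vec \<mu> \<and> \<mu> $ j < 0}"

definition N :: "nat \<Rightarrow> real vec set \<Rightarrow> int \<Rightarrow> nat \<Rightarrow> nat" where
  "N m L \<epsilon> k =
     card {\<mu> \<in> L. norm1 \<mu> = real k + real m / 2 \<and> [int (num_neg \<mu>) = \<epsilon>] (mod 2)}"

definition cube :: "nat \<Rightarrow> nat \<Rightarrow> real vec set" where
  "cube m q = {\<mu> \<in> half_odd m. \<forall>j<m. \<bar>\<mu> $ j\<bar> < real q}"

definition N_red :: "nat \<Rightarrow> nat \<Rightarrow> real vec set \<Rightarrow> int \<Rightarrow> nat \<Rightarrow> nat" where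
  "N_red m q L \<epsilon> k =
     card {\<mu> \<in> L \<inter> cube m q. norm1 \<mu> = real k + real m / 2 \<and> [int (num_neg \<mu>) = \<epsilon>] (mod 2)}"

end

theory Submission
  imports Defs
begin

text \<open>Write an element of the lattice as \<open>half a\<close> with odd entries \<open>a $ j\<close>, and divide each
  \<open>\<bar>a $ j\<bar>\<close> by \<open>2 * q\<close>, keeping the sign on the remainder. Remainders are odd, hence nonzero, so
  signs survive. The vector of remainders lies in the cube and still in the lattice, because both
  defining congruences only depend on \<open>a\<close> modulo \<open>2 * q\<close>. The quotients form an arbitrary vector
  of natural numbers; those with sum \<open>\<beta>\<close> lower the norm by \<open>\<beta> * q\<close> and are counted by the binomial
  coefficient.\<close>

section \<open>Half-integral points as odd integer vectors\<close>

lemma dim_half [simp]: "dim_vec (half a) = dim_vec a"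
  by (simp add: half_def)

lemma half_index [simp]: "j < dim_vec a \<Longrightarrow> half a $ j = real_of_int (a $ j) / 2"
  by (simp add: half_def)

lemma inj_half: "inj half"
proof (rule injI)
  fix a b assume eq: "half a = half b"
  then have d: "dim_vec a = dim_vec b"
    by (metis dim_half)
  show "a = b"
  proof (rule eq_vecI)
    fix j assume "j < dim_vec b"
    then show "a $ j = b $ j"
      using d arg_cong[OF eq, of "\<lambda>v. v $ j"] by simp
  qed (rule d)
qed

lemma half_in_half_odd:
  "half a \<in> half_odd m \<longleftrightarrow> a \<in> carrier_vec m \<and> (\<forall>j<m. odd (a $ j))"
  unfolding half_odd_def using inj_half by (auto dest: injD)

lemma norm1_half:
  assumes "a \<in> carrier_vec m"
  shows "norm1 (half a) = real k + real m / 2 \<longleftrightarrow> (\<Sum>j<m. \<bar>a $ j\<bar>) = 2 * int k + int m"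
proof -
  have "norm1 (half a) = real_of_int (\<Sum>j<m. \<bar>a $ j\<bar>) / 2"
    using assms by (simp add: norm1_def sum_divide_distrib)
  then have "norm1 (half a) = real k + real m / 2 \<longleftrightarrow>
      real_of_int (\<Sum>j<m. \<bar>a $ j\<bar>) = real_of_int (2 * int k + int m)"
    by (auto simp: field_simps)
  then show ?thesis
    by (simp only: of_int_eq_iff)
qed

lemma num_neg_half:
  assumes "a \<in> carrier_vec m"
  shows "num_neg (half a) = card {j. j < m \<and> a $ j < 0}"
  using assms unfolding num_neg_def by (intro arg_cong[where f = card]) auto

lemma half_in_cube:
  assumes "half a \<in> half_odd m"
  shows "half a \<in> cube m q \<longleftrightarrow> (\<forall>j<m. \<bar>a $ j\<bar> < 2 * int q)"
proof -
  have "\<bar>half a $ j\<bar> < real q \<longleftrightarrow> \<bar>a $ j\<bar> < 2 * int q" if "j < m" for j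
  proof -
    have "half a $ j = real_of_int (a $ j) / 2"
      using that assms by (auto simp: half_in_half_odd)
    then show ?thesis
      by linarith
  qed
  then show ?thesis
    using assms by (simp add: cube_def)
qed

text \<open>As \<open>half\<close> is injective, counting can be done on integer vectors. This frees
  all later arguments from real arithmetic.\<close>

lemma card_half_preimage:
  assumes "L \<subseteq> range half"
  shows "card {\<mu> \<in> L. P \<mu>} = card {a. half a \<in> L \<and> P (half a)}"
proof -
  have "{\<mu> \<in> L. P \<mu>} = half ` {a. half a \<in> L \<and> P (half a)}"
    using assms by auto
  then show ?thesis
    by (simp add: card_image inj_on_subset[OF inj_half])
qed

lemma half_odd_subset_range: "half_odd m \<subseteq> range half"
  by (auto simp: half_odd_def)

text \<open>The integer form of the set counted by \<open>N\<close>, with the norm equation doubled.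
  Dimension and oddness of \<open>a\<close> are not repeated: they follow from
  \<open>half a \<in> L\<close> once \<open>L \<subseteq> half_odd m\<close>.\<close>

definition sphere_points :: "nat \<Rightarrow> real vec set \<Rightarrow> int \<Rightarrow> nat \<Rightarrow> int vec set" where
  "sphere_points m L \<epsilon> k = {a. half a \<in> L \<and> (\<Sum>j<m. \<bar>a $ j\<bar>) = 2 * int k + int m \<and>
     [int (card {j. j < m \<and> a $ j < 0}) = \<epsilon>] (mod 2)}"

definition box :: "nat \<Rightarrow> nat \<Rightarrow> int vec set" where
  "box m q = {a \<in> carrier_vec m. \<forall>j<m. \<bar>a $ j\<bar> < 2 * int q}"

lemma N_eq_card:
  assumes "L \<subseteq> half_odd m"
  shows "N m L \<epsilon> k = card (sphere_points m L \<epsilon> k)"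
proof -
  have "{a. half a \<in> L \<and> norm1 (half a) = real k + real m / 2 \<and>
      [int (num_neg (half a)) = \<epsilon>] (mod 2)} = sphere_points m L \<epsilon> k"
    unfolding sphere_points_def
  proof (intro Collect_cong conj_cong refl)
    fix a assume "half a \<in> L"
    then have "a \<in> carrier_vec m"
      using assms half_in_half_odd by blast
    then show "norm1 (half a) = real k + real m / 2 \<longleftrightarrow> (\<Sum>j<m. \<bar>a $ j\<bar>) = 2 * int k + int m"
      "[int (num_neg (half a)) = \<epsilon>] (mod 2) \<longleftrightarrow> [int (card {j. j < m \<and> a $ j < 0}) = \<epsilon>] (mod 2)"
      by (simp_all only: norm1_half num_neg_half)
  qed
  then show ?thesis
    unfolding N_def using assms half_odd_subset_range
    by (subst card_half_preimage) (blast, simp)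
qed

text \<open>The reduced count is the full count for \<open>L \<inter> cube m q\<close>, so
  \<open>N_eq_card\<close> applies; doubling turns the cube into the box.\<close>

lemma N_red_eq_card:
  assumes "L \<subseteq> half_odd m"
  shows "N_red m q L \<epsilon> k = card (sphere_points m L \<epsilon> k \<inter> box m q)"
proof -
  have "N_red m q L \<epsilon> k = N m (L \<inter> cube m q) \<epsilon> k"
    by (simp add: N_red_def N_def)
  moreover have "sphere_points m (L \<inter> cube m q) \<epsilon> k = sphere_points m L \<epsilon> k \<inter> box m q"
  proof (rule Set.set_eqI)
    fix a
    have "half a \<in> cube m q \<longleftrightarrow> a \<in> box m q" if "half a \<in> L"
      using subsetD[OF assms that] half_in_cube by (simp add: box_def half_in_half_odd)
    then show "a \<in> sphere_points m (L \<inter> cube m q) \<epsilon> k \<longleftrightarrow> a \<in> sphere_points m L \<epsilon> k \<inter> box m q"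
      unfolding sphere_points_def by blast
  qed
  ultimately show ?thesis
    using assms by (subst (asm) N_eq_card) auto
qed

section \<open>Finiteness, and the number of quotient vectors\<close>

lemma finite_box: "finite (box m q)"
proof -
  \<comment> \<open>Vectors are read off from lists, since there are finitely many lists of fixed
    length over a finite set.\<close>
  have "box m q \<subseteq> vec_of_list ` {xs. set xs \<subseteq> {- 2 * int q..2 * int q} \<and> length xs = m}"
  proof
    fix a assume a: "a \<in> box m q"
    then have "\<bar>a $ j\<bar> < 2 * int q" if "j < dim_vec a" for j
      using that by (auto simp: box_def)
    then have "set (list_of_vec a) \<subseteq> {- 2 * int q..2 * int q}"
      by (force simp: in_set_conv_nth list_of_vec_index)
    moreover have "length (list_of_vec a) = m"
      using a by (simp add: box_def)
    ultimately show "a \<in> vec_of_list ` {xs. set xs \<subseteq> {- 2 * int q..2 * int q} \<and> length xs = m}"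
      by (metis (mono_tags, lifting) image_eqI mem_Collect_eq vec_list)
  qed
  then show ?thesis
    by (rule finite_subset) (simp add: finite_lists_length_eq)
qed

lemma finite_lists_sum: "finite {x :: nat list. length x = m \<and> sum_list x = \<beta>}"
proof -
  have "{x :: nat list. length x = m \<and> sum_list x = \<beta>} \<subseteq> {x. set x \<subseteq> {..\<beta>} \<and> length x = m}"
    by (auto simp: member_le_sum_list)
  then show ?thesis
    by (rule finite_subset) (simp add: finite_lists_length_eq)
qed

text \<open>Stars and bars. The library count has lower index \<open>\<beta>\<close>; passing to
  \<open>m - 1\<close> by symmetry requires \<open>\<beta> \<le> \<beta> + m - 1\<close>, which is
  where \<open>m > 0\<close> enters.\<close>

lemma card_lists_sum:
  assumes "m > 0"
  shows "card {x :: nat list. length x = m \<and> sum_list x = \<beta>} = (\<beta> + m - 1) choose (m - 1)"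
proof -
  have "(\<beta> + m - 1) choose \<beta> = (\<beta> + m - 1) choose (m - 1)"
    using assms by (subst binomial_symmetric) auto
  then show ?thesis
    by (simp add: card_length_sum_list)
qed

section \<open>Signed division with remainder and its inverse\<close>

definition push_out :: "nat \<Rightarrow> nat list \<times> int vec \<Rightarrow> int vec" where
  "push_out q = (\<lambda>(x, b). vec (dim_vec b) (\<lambda>j. b $ j + sgn (b $ j) * (2 * int q * int (x ! j))))"

text \<open>The division is applied to absolute values, not to the entries themselves:
  \<open>mod\<close> with a positive modulus is never negative and would erase the signs that
  \<open>num_neg\<close> counts. In the other direction, \<open>push_out\<close> moves each nonzero
  coordinate away from 0, so the absolute values simply add.\<close>

definition fold_in :: "nat \<Rightarrow> int vec \<Rightarrow> nat list \<times> int vec" where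
  "fold_in q a = (map (\<lambda>j. nat (\<bar>a $ j\<bar> div (2 * int q))) [0..<dim_vec a],
     vec (dim_vec a) (\<lambda>j. sgn (a $ j) * (\<bar>a $ j\<bar> mod (2 * int q))))"

lemma sgn_add_sgn_mult:
  fixes b c :: int
  assumes "0 \<le> c"
  shows "sgn (b + sgn b * c) = sgn b"
  using assms by (cases b "0 :: int" rule: linorder_cases) simp_all

lemma abs_add_sgn_mult:
  fixes b c :: int
  assumes "0 \<le> c" "b \<noteq> 0"
  shows "\<bar>b + sgn b * c\<bar> = \<bar>b\<bar> + c"
  using assms by (cases b "0 :: int" rule: linorder_cases) simp_all

lemma push_out_carrier: "b \<in> carrier_vec m \<Longrightarrow> push_out q (x, b) \<in> carrier_vec m"
  by (rule carrier_vecI) (simp add: push_out_def)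

lemma push_out_index:
  "b \<in> carrier_vec m \<Longrightarrow> j < m \<Longrightarrow>
    push_out q (x, b) $ j = b $ j + sgn (b $ j) * (2 * int q * int (x ! j))"
  by (simp add: push_out_def)

lemma sgn_push_out:
  assumes "b \<in> carrier_vec m" "j < m"
  shows "sgn (push_out q (x, b) $ j) = sgn (b $ j)"
  unfolding push_out_index[OF assms] by (rule sgn_add_sgn_mult) simp

lemma abs_push_out:
  assumes "b \<in> carrier_vec m" "j < m" "odd (b $ j)"
  shows "\<bar>push_out q (x, b) $ j\<bar> = \<bar>b $ j\<bar> + 2 * int q * int (x ! j)"
proof -
  have "b $ j \<noteq> 0"
    using assms(3) by (metis dvd_0_right)
  then show ?thesis
    unfolding push_out_index[OF assms(1,2)] by (intro abs_add_sgn_mult) simp_all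
qed

lemma length_fst_fold_in: "a \<in> carrier_vec m \<Longrightarrow> length (fst (fold_in q a)) = m"
  by (simp add: fold_in_def)

lemma fst_fold_in_index:
  "a \<in> carrier_vec m \<Longrightarrow> j < m \<Longrightarrow> fst (fold_in q a) ! j = nat (\<bar>a $ j\<bar> div (2 * int q))"
  by (simp add: fold_in_def)

lemma int_fst_fold_in_index:
  assumes "a \<in> carrier_vec m" "j < m" "q > 0"
  shows "int (fst (fold_in q a) ! j) = \<bar>a $ j\<bar> div (2 * int q)"
  unfolding fst_fold_in_index[OF assms(1,2)] using assms(3) by (simp add: pos_imp_zdiv_nonneg_iff)

lemma snd_fold_in_carrier: "a \<in> carrier_vec m \<Longrightarrow> snd (fold_in q a) \<in> carrier_vec m"
  by (rule carrier_vecI) (simp add: fold_in_def)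

lemma snd_fold_in_index:
  "a \<in> carrier_vec m \<Longrightarrow> j < m \<Longrightarrow>
    snd (fold_in q a) $ j = sgn (a $ j) * (\<bar>a $ j\<bar> mod (2 * int q))"
  by (simp add: fold_in_def)

text \<open>A zero remainder would make the even number \<open>2 * d\<close> a divisor of
  \<open>a\<close>.\<close>

lemma odd_mod_pos:
  fixes a d :: int
  assumes "odd a" "0 < d"
  shows "0 < \<bar>a\<bar> mod (2 * d)"
proof -
  have "\<bar>a\<bar> mod (2 * d) \<noteq> 0"
    using assms(1) by (metis dvd_abs_iff dvd_mult_left mod_eq_0_iff_dvd)
  then show ?thesis
    using assms(2) by (simp add: order_less_le)
qed

lemma sgn_snd_fold_in:
  assumes "a \<in> carrier_vec m" "j < m" "odd (a $ j)" "q > 0"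
  shows "sgn (snd (fold_in q a) $ j) = sgn (a $ j)"
proof -
  have "0 < \<bar>a $ j\<bar> mod (2 * int q)"
    using assms(3,4) by (intro odd_mod_pos) simp_all
  then show ?thesis
    by (simp only: snd_fold_in_index[OF assms(1,2)] sgn_mult sgn_pos mult_1_right sgn_sgn)
qed

lemma abs_snd_fold_in:
  assumes "a \<in> carrier_vec m" "j < m" "odd (a $ j)" "q > 0"
  shows "\<bar>snd (fold_in q a) $ j\<bar> = \<bar>a $ j\<bar> mod (2 * int q)"
proof -
  have "0 < \<bar>a $ j\<bar> mod (2 * int q)"
    using assms(3,4) by (intro odd_mod_pos) simp_all
  moreover have "\<bar>sgn (a $ j)\<bar> = 1"
    using assms(3) by (simp add: abs_sgn_eq) (metis dvd_0_right)
  ultimately show ?thesis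
    by (simp only: snd_fold_in_index[OF assms(1,2)] abs_mult abs_of_pos mult_1_left)
qed

text \<open>The remainder is congruent to the absolute value; multiplying by the sign of the entry
  recovers the entry itself.\<close>

lemma cong_snd_fold_in:
  assumes "a \<in> carrier_vec m" "j < m"
  shows "[snd (fold_in q a) $ j = a $ j] (mod 2 * int q)"
proof -
  have "[sgn (a $ j) * (\<bar>a $ j\<bar> mod (2 * int q)) = sgn (a $ j) * \<bar>a $ j\<bar>] (mod 2 * int q)"
    by (rule cong_scalar_left) (simp add: cong_def)
  then show ?thesis
    by (simp only: snd_fold_in_index[OF assms] sgn_mult_abs)
qed

lemma push_out_fold_in:
  assumes a: "a \<in> carrier_vec m" and odd: "\<And>j. j < m \<Longrightarrow> odd (a $ j)" and q: "q > 0"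
  shows "push_out q (fold_in q a) = a"
proof (rule eq_vecI)
  show "dim_vec (push_out q (fold_in q a)) = dim_vec a"
    using push_out_carrier[OF snd_fold_in_carrier[OF a, of q], of q "fst (fold_in q a)"] a
    by (simp only: prod.collapse carrier_dim_vec)
  fix j assume "j < dim_vec a"
  then have j: "j < m"
    using a by simp
  \<comment> \<open>The remainder has the same sign as \<open>a $ j\<close>, so that sign factors
    out of both summands and leaves the division identity for the absolute value.\<close>
  have "push_out q (fst (fold_in q a), snd (fold_in q a)) $ j =
      sgn (a $ j) * (\<bar>a $ j\<bar> mod (2 * int q) + 2 * int q * (\<bar>a $ j\<bar> div (2 * int q)))"
    unfolding push_out_index[OF snd_fold_in_carrier[OF a] j] sgn_snd_fold_in[OF a j odd[OF j] q]
    unfolding snd_fold_in_index[OF a j] int_fst_fold_in_index[OF a j q] distrib_left ..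
  then show "push_out q (fold_in q a) $ j = a $ j"
    by (simp only: prod.collapse mod_mult_div_eq sgn_mult_abs)
qed

lemma fold_in_push_out:
  assumes b: "b \<in> box m q" and odd: "\<And>j. j < m \<Longrightarrow> odd (b $ j)" and x: "length x = m"
  shows "fold_in q (push_out q (x, b)) = (x, b)"
proof (rule prod_eqI)
  have bc: "b \<in> carrier_vec m" and bd: "\<And>j. j < m \<Longrightarrow> \<bar>b $ j\<bar> < 2 * int q"
    using b by (simp_all add: box_def)
  note pc = push_out_carrier[OF bc, of q x]
  \<comment> \<open>Uniqueness of division with remainder: the box condition makes the absolute
    value of \<open>b $ j\<close> a legitimate remainder.\<close>
  have abs_div: "\<bar>push_out q (x, b) $ j\<bar> div (2 * int q) = int (x ! j)"
    and abs_mod: "\<bar>push_out q (x, b) $ j\<bar> mod (2 * int q) = \<bar>b $ j\<bar>" if "j < m" for j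
    using bd[OF that] by (simp_all add: abs_push_out[OF bc that odd[OF that]])
  show "fst (fold_in q (push_out q (x, b))) = fst (x, b)"
  proof (rule nth_equalityI)
    show "length (fst (fold_in q (push_out q (x, b)))) = length (fst (x, b))"
      by (simp add: length_fst_fold_in[OF pc] x)
    fix j assume "j < length (fst (fold_in q (push_out q (x, b))))"
    then have j: "j < m"
      by (simp add: length_fst_fold_in[OF pc])
    show "fst (fold_in q (push_out q (x, b))) ! j = fst (x, b) ! j"
      by (simp only: fst_fold_in_index[OF pc j] abs_div[OF j] nat_int fst_conv)
  qed
  show "snd (fold_in q (push_out q (x, b))) = snd (x, b)"
  proof (rule eq_vecI)
    show "dim_vec (snd (fold_in q (push_out q (x, b)))) = dim_vec (snd (x, b))"
      by (simp only: carrier_vecD[OF snd_fold_in_carrier[OF pc]] carrier_vecD[OF bc] snd_conv)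
    fix j assume "j < dim_vec (snd (x, b))"
    then have j: "j < m"
      using bc by simp
    show "snd (fold_in q (push_out q (x, b))) $ j = snd (x, b) $ j"
      by (simp only: snd_fold_in_index[OF pc j] sgn_push_out[OF bc j] abs_mod[OF j]
          sgn_mult_abs snd_conv)
  qed
qed

section \<open>The bijection between folded points and lattice points\<close>

lemma card_neg_cong:
  fixes a b :: "int vec"
  assumes "\<And>j. j < m \<Longrightarrow> sgn (a $ j) = sgn (b $ j)"
  shows "card {j. j < m \<and> a $ j < 0} = card {j. j < m \<and> b $ j < 0}"
proof -
  have "j < m \<and> a $ j < 0 \<longleftrightarrow> j < m \<and> b $ j < 0" for j
    using assms[of j] sgn_less[of "a $ j"] sgn_less[of "b $ j"] by metis
  then show ?thesis
    by (simp only:)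
qed

text \<open>Invariance under translation by \<open>d\<close> times integer vectors. It lets the
  counting argument treat odd and even \<open>q\<close> together, with
  \<open>d = 2 * int q\<close>.\<close>

definition periodic :: "nat \<Rightarrow> int \<Rightarrow> real vec set \<Rightarrow> bool" where
  "periodic m d L \<longleftrightarrow> (\<forall>a b. half a \<in> L \<longrightarrow> b \<in> carrier_vec m \<longrightarrow>
     (\<forall>j<m. [a $ j = b $ j] (mod d)) \<longrightarrow> half b \<in> L)"

lemma periodicD:
  assumes "periodic m d L" "half a \<in> L" "b \<in> carrier_vec m"
    "\<And>j. j < m \<Longrightarrow> [b $ j = a $ j] (mod d)"
  shows "half b \<in> L"
  using assms(1,2,3) cong_sym[OF assms(4)] unfolding periodic_def by blast

text \<open>The sum is the norm equation for \<open>push_out q (x, b)\<close>: by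
  \<open>abs_push_out\<close>, its summands are the absolute values of the entries of that vector
  when the entries of \<open>b\<close> are odd.\<close>

definition folded_points ::
    "nat \<Rightarrow> nat \<Rightarrow> real vec set \<Rightarrow> int \<Rightarrow> nat \<Rightarrow> (nat list \<times> int vec) set" where
  "folded_points m q L \<epsilon> k = {(x, b). length x = m \<and> b \<in> box m q \<and> half b \<in> L \<and>
     (\<Sum>j<m. \<bar>b $ j\<bar> + 2 * int q * int (x ! j)) = 2 * int k + int m \<and>
     [int (card {j. j < m \<and> b $ j < 0}) = \<epsilon>] (mod 2)}"

text \<open>Pushing out changes entries by multiples of \<open>2 * int q\<close>, so periodicity
  keeps the point in \<open>L\<close>; signs are unchanged, and with them the parity
  condition.\<close>

lemma push_out_in_sphere_points:
  assumes L: "L \<subseteq> half_odd m" and per: "periodic m (2 * int q) L"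
    and xb: "(x, b) \<in> folded_points m q L \<epsilon> k"
  shows "push_out q (x, b) \<in> sphere_points m L \<epsilon> k"
proof -
  have b: "half b \<in> L"
    and sum: "(\<Sum>j<m. \<bar>b $ j\<bar> + 2 * int q * int (x ! j)) = 2 * int k + int m"
    and sg: "[int (card {j. j < m \<and> b $ j < 0}) = \<epsilon>] (mod 2)"
    using xb by (simp_all add: folded_points_def)
  have "half b \<in> half_odd m"
    using b L by blast
  then have bc: "b \<in> carrier_vec m" and odd: "\<And>j. j < m \<Longrightarrow> odd (b $ j)"
    by (simp_all add: half_in_half_odd)
  have "[push_out q (x, b) $ j = b $ j] (mod 2 * int q)" if "j < m" for j
    by (simp add: push_out_index[OF bc that] cong_iff_dvd_diff)
  then have "half (push_out q (x, b)) \<in> L"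
    by (rule periodicD[OF per b push_out_carrier[OF bc]])
  moreover have "(\<Sum>j<m. \<bar>push_out q (x, b) $ j\<bar>) = 2 * int k + int m"
    unfolding sum[symmetric] by (rule sum.cong) (simp_all only: lessThan_iff abs_push_out[OF bc _ odd])
  moreover have "card {j. j < m \<and> push_out q (x, b) $ j < 0} = card {j. j < m \<and> b $ j < 0}"
    by (rule card_neg_cong) (rule sgn_push_out[OF bc])
  ultimately show ?thesis
    using sg by (simp only: sphere_points_def mem_Collect_eq simp_thms)
qed

lemma fold_in_in_folded_points:
  assumes q: "q > 0" and L: "L \<subseteq> half_odd m" and per: "periodic m (2 * int q) L"
    and "a \<in> sphere_points m L \<epsilon> k"
  shows "fold_in q a \<in> folded_points m q L \<epsilon> k"
proof -
  have a: "half a \<in> L" and sum: "(\<Sum>j<m. \<bar>a $ j\<bar>) = 2 * int k + int m"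
    and sg: "[int (card {j. j < m \<and> a $ j < 0}) = \<epsilon>] (mod 2)"
    using assms(4) by (simp_all add: sphere_points_def)
  have "half a \<in> half_odd m"
    using a L by blast
  then have ac: "a \<in> carrier_vec m" and odd: "\<And>j. j < m \<Longrightarrow> odd (a $ j)"
    by (simp_all add: half_in_half_odd)
  note abs = abs_snd_fold_in[OF ac _ odd q]
  let ?x = "fst (fold_in q a)" and ?b = "snd (fold_in q a)"
  have "?b \<in> box m q"
    using q by (simp add: box_def snd_fold_in_carrier[OF ac] abs)
  moreover have "half ?b \<in> L"
    by (rule periodicD[OF per a snd_fold_in_carrier[OF ac] cong_snd_fold_in[OF ac]])
  \<comment> \<open>Remainder plus modulus times quotient restores the absolute value of
    \<open>a $ j\<close> in each summand.\<close>
  moreover have "(\<Sum>j<m. \<bar>?b $ j\<bar> + 2 * int q * int (?x ! j)) = 2 * int k + int m"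
    unfolding sum[symmetric]
    by (rule sum.cong) (simp_all only: lessThan_iff abs int_fst_fold_in_index[OF ac _ q] mod_mult_div_eq)
  moreover have "card {j. j < m \<and> ?b $ j < 0} = card {j. j < m \<and> a $ j < 0}"
    by (rule card_neg_cong) (rule sgn_snd_fold_in[OF ac _ odd q])
  ultimately have "(?x, ?b) \<in> folded_points m q L \<epsilon> k"
    using sg length_fst_fold_in[OF ac]
    by (simp only: folded_points_def mem_Collect_eq prod.case simp_thms)
  then show ?thesis
    by (simp only: prod.collapse)
qed

lemma bij_betw_push_out:
  assumes q: "q > 0" and L: "L \<subseteq> half_odd m" and per: "periodic m (2 * int q) L"
  shows "bij_betw (push_out q) (folded_points m q L \<epsilon> k) (sphere_points m L \<epsilon> k)"
proof (rule bij_betw_byWitness[where f' = "fold_in q"])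
  have carr: "a \<in> carrier_vec m" and odd: "\<And>j. j < m \<Longrightarrow> odd (a $ j)" if "half a \<in> L" for a
    using subsetD[OF L that] by (simp_all add: half_in_half_odd)
  show "\<forall>z \<in> folded_points m q L \<epsilon> k. fold_in q (push_out q z) = z"
  proof clarify
    fix x b assume "(x, b) \<in> folded_points m q L \<epsilon> k"
    then have "length x = m" "b \<in> box m q" "half b \<in> L"
      by (simp_all add: folded_points_def)
    then show "fold_in q (push_out q (x, b)) = (x, b)"
      by (intro fold_in_push_out odd)
  qed
  show "\<forall>a \<in> sphere_points m L \<epsilon> k. push_out q (fold_in q a) = a"
  proof
    fix a assume "a \<in> sphere_points m L \<epsilon> k"
    then have "half a \<in> L"
      by (simp add: sphere_points_def)
    then show "push_out q (fold_in q a) = a"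
      by (intro push_out_fold_in[OF carr odd q])
  qed
  show "push_out q ` folded_points m q L \<epsilon> k \<subseteq> sphere_points m L \<epsilon> k"
    using push_out_in_sphere_points[OF L per] by auto
  show "fold_in q ` sphere_points m L \<epsilon> k \<subseteq> folded_points m q L \<epsilon> k"
    using fold_in_in_folded_points[OF q L per] by blast
qed

section \<open>Counting folded points by the sum of the quotients\<close>

lemma sum_list_mult_le_if_folded:
  assumes L: "L \<subseteq> half_odd m" and "half b \<in> L"
    and sum: "(\<Sum>j<m. \<bar>b $ j\<bar>) + 2 * (int (sum_list x) * int q) = 2 * int k + int m"
  shows "sum_list x * q \<le> k"
proof -
  have "half b \<in> half_odd m"
    using assms by blast
  then have "1 \<le> \<bar>b $ j\<bar>" if "j < m" for j
    using that by (cases "b $ j = 0") (auto simp: half_in_half_odd)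
  \<comment> \<open>Odd entries contribute at least 1 each. They use up the term
    \<open>int m\<close> of the norm equation, which leaves at most \<open>k\<close> for the
    quotients.\<close>
  then have "int m \<le> (\<Sum>j<m. \<bar>b $ j\<bar>)"
    using sum_mono[of "{..<m}" "\<lambda>_. 1" "\<lambda>j. \<bar>b $ j\<bar>"] by simp
  then have "int (sum_list x) * int q \<le> int k"
    using sum by linarith
  then show ?thesis
    by (simp only: of_nat_le_iff flip: of_nat_mult)
qed

text \<open>For fixed \<open>\<beta> = sum_list x\<close> the quotients and the remainder vector can
  be chosen independently, so each piece is a full product.\<close>

lemma folded_points_eq_UN:
  assumes q: "q > 0" and L: "L \<subseteq> half_odd m"
  shows "folded_points m q L \<epsilon> k = (\<Union>\<beta> \<in> {0..k div q}. {x. length x = m \<and> sum_list x = \<beta>} \<times>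
    (sphere_points m L \<epsilon> (k - \<beta> * q) \<inter> box m q))"
proof (rule Set.set_eqI, clarify)
  fix x b
  have "(\<Sum>j<m. \<bar>b $ j\<bar> + 2 * int q * int (x ! j)) =
      (\<Sum>j<m. \<bar>b $ j\<bar>) + 2 * (int (sum_list x) * int q)" if "length x = m"
    using that
    by (simp add: sum_list_sum_nth atLeast0LessThan sum.distrib sum_distrib_left sum_distrib_right ac_simps)
  then have "(\<Sum>j<m. \<bar>b $ j\<bar> + 2 * int q * int (x ! j)) = 2 * int k + int m \<longleftrightarrow>
      (\<Sum>j<m. \<bar>b $ j\<bar>) + 2 * (int (sum_list x) * int q) = 2 * int k + int m" if "length x = m"
    using that by (simp only:)
  \<comment> \<open>Subtraction on naturals truncates, so the two equations are compared only where
    \<open>sum_list x * q \<le> k\<close>.\<close>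
  moreover have "(\<Sum>j<m. \<bar>b $ j\<bar>) = 2 * int (k - sum_list x * q) + int m \<longleftrightarrow>
      (\<Sum>j<m. \<bar>b $ j\<bar>) + 2 * (int (sum_list x) * int q) = 2 * int k + int m"
    if "sum_list x * q \<le> k"
    using that by (simp only: of_nat_diff of_nat_mult) (auto simp: right_diff_distrib)
  \<comment> \<open>The bound \<open>sum_list x * q \<le> k\<close> is not part of
    \<open>folded_points\<close>; it comes from \<open>sum_list_mult_le_if_folded\<close>, and
    becomes the upper limit \<open>k div q\<close> of the union.\<close>
  ultimately have "(x, b) \<in> folded_points m q L \<epsilon> k \<longleftrightarrow> length x = m \<and> sum_list x * q \<le> k \<and>
      b \<in> sphere_points m L \<epsilon> (k - sum_list x * q) \<inter> box m q"
    unfolding folded_points_def sphere_points_def mem_Collect_eq prod.case Int_iff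
    using sum_list_mult_le_if_folded[OF L, of b x q k] by blast
  then show "(x, b) \<in> folded_points m q L \<epsilon> k \<longleftrightarrow>
      (x, b) \<in> (\<Union>\<beta> \<in> {0..k div q}. {x. length x = m \<and> sum_list x = \<beta>} \<times>
        (sphere_points m L \<epsilon> (k - \<beta> * q) \<inter> box m q))"
    by (simp add: less_eq_div_iff_mult_less_eq[OF q])
qed

text \<open>The counting formula for any periodic set of half-odd points; spin structures enter only
  when it is applied.\<close>

lemma N_eq_sum_N_red:
  assumes "m > 0" "q > 0" and L: "L \<subseteq> half_odd m" and per: "periodic m (2 * int q) L"
  shows "N m L \<epsilon> k =
    (\<Sum>\<beta> = 0..k div q. ((\<beta> + m - 1) choose (m - 1)) * N_red m q L \<epsilon> (k - \<beta> * q))"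
proof -
  let ?X = "\<lambda>\<beta>. {x :: nat list. length x = m \<and> sum_list x = \<beta>}"
  let ?S = "\<lambda>\<beta>. sphere_points m L \<epsilon> (k - \<beta> * q) \<inter> box m q"
  have "N m L \<epsilon> k = card (\<Union>\<beta> \<in> {0..k div q}. ?X \<beta> \<times> ?S \<beta>)"
    by (simp only: N_eq_card[OF L] folded_points_eq_UN[OF assms(2) L, symmetric]
        bij_betw_same_card[OF bij_betw_push_out[OF assms(2) L per]])
  also have "\<dots> = (\<Sum>\<beta> = 0..k div q. card (?X \<beta> \<times> ?S \<beta>))"
    \<comment> \<open>The pieces are disjoint because \<open>\<beta>\<close> is determined by the
      list component.\<close>
    by (intro card_UN_disjoint) (auto simp: finite_lists_sum finite_box)
  also have "\<dots> = (\<Sum>\<beta> = 0..k div q. ((\<beta> + m - 1) choose (m - 1)) * N_red m q L \<epsilon> (k - \<beta> * q))"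
    by (simp only: card_cartesian_product card_lists_sum[OF assms(1)] N_red_eq_card[OF L])
  finally show ?thesis .
qed

section \<open>Periodicity of the congruence lattices\<close>

lemma cong_weighted_sum:
  fixes s :: "int vec"
  assumes "\<forall>j<m. [a $ j = b $ j] (mod d)"
  shows "[(\<Sum>j<m. a $ j * s $ j) = (\<Sum>j<m. b $ j * s $ j)] (mod d)"
  using assms by (intro cong_sum cong_mult cong_refl) auto

text \<open>An even \<open>d\<close> preserves the parity of every entry, and \<open>e dvd d\<close>
  preserves the weighted congruence.\<close>

lemma periodic_congruence_set:
  fixes d e :: int
  assumes "even d" "e dvd d"
  shows "periodic m d {half a | a. half a \<in> half_odd m \<and> [(\<Sum>j<m. a $ j * s $ j) = c] (mod e)}"
  unfolding periodic_def
proof (intro allI impI, goal_cases)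
  case (1 a b)
  then have a: "half a \<in> half_odd m" "[(\<Sum>j<m. a $ j * s $ j) = c] (mod e)"
    using inj_half by (auto dest: injD)
  have "odd (b $ j)" if "j < m" for j
    using 1(3) a(1) assms(1) that
    by (metis cong_dvd_iff cong_dvd_modulus half_in_half_odd)
  moreover have "[(\<Sum>j<m. b $ j * s $ j) = c] (mod e)"
    using cong_trans[OF cong_sym[OF cong_weighted_sum] a(2)] 1(3) assms(2)
    by (meson cong_dvd_modulus)
  ultimately show ?case
    using 1(2) by (auto simp: half_in_half_odd)
qed

theorem proposition6p1:
  fixes m q k :: nat and s :: "int vec" and \<tau> :: "real mat \<Rightarrow> cliff"
    and L :: "real vec set" and \<epsilon> :: int
  assumes "m \<ge> 2"
    and "spin_lens_space m q s \<tau>"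
    and "affine_congruence_lattice m q s \<tau> L"
  shows "N m L \<epsilon> k =
    (\<Sum>\<beta> = 0..k div q. ((\<beta> + m - 1) choose (m - 1)) * N_red m q L \<epsilon> (k - \<beta> * q))"
proof (rule N_eq_sum_N_red)
  show "m > 0" "q > 0"
    using assms by (auto simp: spin_lens_space_def)
  show "L \<subseteq> half_odd m"
    using assms(3)
    by (auto simp: affine_congruence_lattice_def lattice_odd_def lattice_even_def split: if_splits)
  \<comment> \<open>Here \<open>e\<close> is \<open>int q\<close> for odd \<open>q\<close> and
    \<open>2 * int q\<close> for even \<open>q\<close>; the label of the spin structure is absorbed
    into the constant \<open>c\<close>.\<close>
  show "periodic m (2 * int q) L"
    using assms(3) unfolding affine_congruence_lattice_def lattice_odd_def lattice_even_def
    by (auto intro!: periodic_congruence_set split: if_splits)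
qed

end
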